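(* Let $\sigma > 0$ and let $s$ be the unique maximal real solution of $s''(t) = 2 s(t)^3 - t\, s(t)$ with $s(0) = 0$ and $s'(0) = \sigma$, defined on its maximal open interval of existence $J_s \ni 0$. If $s$ is strictly increasing on $J_s \cap [0,\infty)$, then $s$ does not blow up (in positive time) before time $\pi/\sqrt{4\sigma}$; that is, $\left[0, \pi/\sqrt{4\sigma}\right) \subseteq J_s$.
   Context: All functions are real-valued functions of a real variable $t$. The maximal interval $J_s$ is the largest open interval about $0$ on which the solution of the initial value problem exists; the behaviour of $s$ is considered on $J_s \cap [0,\infty)$. The solution blows up at a positive time $t^*$ if $J_s \cap [0,\infty) = [0,t^* )$ with $t^*<\infty$. *)

theory Defs
  imports "HOL-Analysis.Analysis"
begin

(* Only the values of s on J matter: since J is open, deriv s on J is determined by s on J. *)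
definition ivp_solution :: "real \<Rightarrow> real set \<Rightarrow> (real \<Rightarrow> real) \<Rightarrow> bool" where
  "ivp_solution \<sigma> J s \<longleftrightarrow>
     open J \<and> is_interval J \<and> 0 \<in> J \<and>
     (\<forall>t\<in>J. (s has_real_derivative deriv s t) (at t) \<and>
            (deriv s has_real_derivative 2 * s t ^ 3 - t * s t) (at t)) \<and>
     s 0 = 0 \<and> deriv s 0 = \<sigma>"

definition maximal_ivp_solution :: "real \<Rightarrow> real set \<Rightarrow> (real \<Rightarrow> real) \<Rightarrow> bool" where
  "maximal_ivp_solution \<sigma> J s \<longleftrightarrow>
     ivp_solution \<sigma> J s \<and> (\<forall>K u. ivp_solution \<sigma> K u \<longrightarrow> K \<subseteq> J)"

definition blows_up_at :: "real set \<Rightarrow> real \<Rightarrow> bool" where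
  "blows_up_at J T \<longleftrightarrow> J \<inter> {0..} = {0..<T}"

end

theory Submission
  imports Defs
begin

text \<open>
  Let \<open>s\<close> be an increasing solution on \<open>J\<close>. For \<open>t \<ge> 0\<close> the linear term \<open>- t s\<close> only brakes the
  growth: since \<open>s\<close> and \<open>s'\<close> are nonnegative, the energy \<open>s'\<^sup>2 - s\<^sup>4\<close> of the equation \<open>s'' = 2 s\<^sup>3\<close>
  never exceeds its initial value \<open>\<sigma>\<^sup>2\<close>. Hence \<open>s'\<^sup>2 \<le> s\<^sup>4 + \<sigma>\<^sup>2 \<le> (s\<^sup>2 + \<sigma>)\<^sup>2\<close>, and \<open>s\<close> is a subsolution
  of the Riccati equation \<open>y' = y\<^sup>2 + \<sigma>\<close>, whose solution \<open>\<surd>\<sigma> tan (\<surd>\<sigma> t)\<close> through the origin becomes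
  infinite exactly at \<open>\<pi> / (2 \<surd>\<sigma>) = \<pi> / \<surd>(4 \<sigma>)\<close>. So \<open>s\<close> and \<open>s'\<close> stay bounded on \<open>J \<inter> {0..X}\<close> for
  every \<open>X\<close> before that time (\<open>increasing_solution_bound\<close>).

  It remains to see that a solution with bounded \<open>s\<close> and \<open>s'\<close> cannot stop. The equation can be
  solved forward from any data in a bounded region over a time span \<open>d\<close> that depends only on the
  region (\<open>cubic_ivp_uniform_step\<close>, a contraction argument). Restarting the solution at a time \<open>t0\<close>
  closer than \<open>d\<close> to the right end of \<open>J\<close> produces a solution beyond that end
  (\<open>ivp_solution_extend\<close>), against maximality. Restarting strictly inside \<open>J\<close> means that neither
  the limits of \<open>s\<close> and \<open>s'\<close> at the end point nor uniqueness of solutions have to be discussed: the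
  two pieces are spliced at a point where both have the same value and the same derivative.
\<close>

section \<open>Local existence with a quantitative step\<close>

text \<open>
  Integrating \<open>y'' = f t y\<close> twice from \<open>t0\<close>, with \<open>a\<close> and \<open>b\<close> as initial value and slope, turns
  the initial value problem into a fixed point equation for \<open>y\<close>. The bound on \<open>\<bar>b\<bar> * d + C * d\<^sup>2\<close> keeps the iteration
  inside the tube of radius \<open>r\<close> where \<open>f\<close> is controlled, and the double integral contracts by the
  factor \<open>L * d\<^sup>2\<close>. All constants are explicit so that one \<open>d\<close> can serve many initial data.
\<close>

lemma second_order_ivp_exists:
  fixes f :: "real \<Rightarrow> real \<Rightarrow> real"
  assumes d: "0 < d" and r: "0 \<le> r"
    and cont: "continuous_on ({t0..t0 + d} \<times> cball a r) (\<lambda>(t, y). f t y)"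
    and bound: "\<And>t y. t \<in> {t0..t0 + d} \<Longrightarrow> y \<in> cball a r \<Longrightarrow> \<bar>f t y\<bar> \<le> C"
    and lip: "\<And>t y z. t \<in> {t0..t0 + d} \<Longrightarrow> y \<in> cball a r \<Longrightarrow> z \<in> cball a r \<Longrightarrow>
                \<bar>f t y - f t z\<bar> \<le> L * \<bar>y - z\<bar>"
    and step: "\<bar>b\<bar> * d + C * d\<^sup>2 \<le> r" and contr: "0 \<le> L" "L * d\<^sup>2 < 1"
  obtains v v' where "v t0 = a" and "v' t0 = b"
    and "\<And>t. t \<in> {t0..<t0 + d} \<Longrightarrow> (v has_real_derivative v' t) (at t within {t0..})"
    and "\<And>t. t \<in> {t0..<t0 + d} \<Longrightarrow> (v' has_real_derivative f t (v t)) (at t within {t0..})"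
proof -
  \<comment> \<open>Freezing the integral outside the time interval turns it into an operator on bounded
    continuous functions on the whole line, which form a complete space.\<close>
  define clamp where "clamp t = max t0 (min t (t0 + d))" for t
  define W where "W y t = b + integral {t0..t} (\<lambda>q. f q (y q))" for y t
  define P where "P y t = a + integral {t0..clamp t} (W y)" for y t
  define S where "S = cball (const_bcontfun a :: real \<Rightarrow>\<^sub>C real) r"
  have clamp: "clamp t \<in> {t0..t0 + d}" for t
    using d by (auto simp: clamp_def)
  have S_val: "apply_bcontfun y t \<in> cball a r" if "y \<in> S" for y t
    using that dist_bounded[of "const_bcontfun a" t y]
    by (auto simp: S_def const_bcontfun.rep_eq)
  have cont_f: "continuous_on {t0..t} (\<lambda>q. f q (y q))" if "y \<in> S" "t \<in> {t0..t0 + d}"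
    for y :: "real \<Rightarrow>\<^sub>C real" and t
  proof -
    have "continuous_on {t0..t} ((\<lambda>(q, y). f q y) \<circ> (\<lambda>q. (q, y q)))"
      by (intro continuous_on_compose continuous_intros continuous_on_subset[OF cont])
        (use S_val that in auto)
    then show ?thesis by (simp add: o_def)
  qed
  have deriv_W: "(W y has_real_derivative f t (y t)) (at t within {t0..t0 + d})"
    if "y \<in> S" "t \<in> {t0..t0 + d}" for y :: "real \<Rightarrow>\<^sub>C real" and t
    unfolding W_def
    by (rule derivative_eq_intros integral_has_real_derivative[OF cont_f] that | use d that in simp)+
  have cont_W: "continuous_on {t0..t} (W y)" if "y \<in> S" "t \<in> {t0..t0 + d}"
    for y :: "real \<Rightarrow>\<^sub>C real" and t
    by (rule continuous_on_subset[OF DERIV_continuous_on[OF deriv_W]]) (use that in auto)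
  have cont_P: "continuous_on UNIV (P y)" if "y \<in> S" for y :: "real \<Rightarrow>\<^sub>C real"
  proof -
    have "continuous_on {t0..t0 + d} (\<lambda>t. integral {t0..t} (W y))"
      by (intro indefinite_integral_continuous_1 integrable_continuous_real cont_W that) (use d in auto)
    then have "continuous_on UNIV (\<lambda>t. integral {t0..clamp t} (W y))"
      by (rule continuous_on_compose2) (use clamp in \<open>auto simp: clamp_def intro!: continuous_intros\<close>)
    then show ?thesis
      unfolding P_def by (intro continuous_intros)
  qed
  have C0: "0 \<le> C"
    using bound[of t0 a] d r by auto
  have W_bound: "\<bar>W y t\<bar> \<le> \<bar>b\<bar> + C * d" if "y \<in> S" "t \<in> {t0..t0 + d}"
    for y :: "real \<Rightarrow>\<^sub>C real" and t
  proof -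
    have "norm (integral {t0..t} (\<lambda>q. f q (y q))) \<le> C * (t - t0)"
      by (intro integral_bound cont_f that) (use that S_val bound in auto)
    also have "\<dots> \<le> C * d"
      using that C0 by (intro mult_left_mono) auto
    finally show ?thesis by (simp add: W_def)
  qed
  have P_bound: "dist a (P y t) \<le> r" if "y \<in> S" for y :: "real \<Rightarrow>\<^sub>C real" and t
  proof -
    have "norm (integral {t0..clamp t} (W y)) \<le> (\<bar>b\<bar> + C * d) * (clamp t - t0)"
      by (rule integral_bound) (use W_bound cont_W that clamp[of t] in auto)
    also have "\<dots> \<le> (\<bar>b\<bar> + C * d) * d"
      using clamp[of t] C0 d by (intro mult_left_mono) auto
    also have "\<dots> \<le> r"
      using step by (simp add: algebra_simps power2_eq_square)
    finally show ?thesis by (simp add: P_def dist_real_def)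
  qed
  have P_bcont: "P y \<in> bcontfun" if "y \<in> S" for y :: "real \<Rightarrow>\<^sub>C real"
    using cont_P[OF that] P_bound[OF that] by (auto simp: bcontfun_def bounded_def)
  define \<Phi> where "\<Phi> y = Bcontfun (P (apply_bcontfun y))" for y
  have \<Phi>: "apply_bcontfun (\<Phi> y) = P y" if "y \<in> S" for y
    using P_bcont[OF that] by (simp add: \<Phi>_def Bcontfun_inverse)
  have W_lip: "\<bar>W y t - W z t\<bar> \<le> L * dist y z * d" if "y \<in> S" "z \<in> S" "t \<in> {t0..t0 + d}"
    for y z :: "real \<Rightarrow>\<^sub>C real" and t
  proof -
    have "W y t - W z t = integral {t0..t} (\<lambda>q. f q (y q) - f q (z q))"
      unfolding W_def using that
      by (subst Henstock_Kurzweil_Integration.integral_diff)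
        (auto intro!: integrable_continuous_real cont_f)
    moreover have "norm (integral {t0..t} (\<lambda>q. f q (y q) - f q (z q))) \<le> L * dist y z * (t - t0)"
    proof (intro integral_bound continuous_intros cont_f that)
      fix q assume "q \<in> {t0..t}"
      then have "\<bar>f q (y q) - f q (z q)\<bar> \<le> L * \<bar>y q - z q\<bar>"
        using that S_val by (intro lip) auto
      also have "\<dots> \<le> L * dist y z"
        using dist_bounded[of y q z] contr by (intro mult_left_mono) (auto simp: dist_real_def)
      finally show "norm (f q (y q) - f q (z q)) \<le> L * dist y z" by simp
    qed (use that in auto)
    moreover have "L * dist y z * (t - t0) \<le> L * dist y z * d"
      using that contr by (intro mult_left_mono) auto
    ultimately show ?thesis by simp
  qed
  have P_lip: "dist (P y t) (P z t) \<le> L * d\<^sup>2 * dist y z" if "y \<in> S" "z \<in> S"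
    for y z :: "real \<Rightarrow>\<^sub>C real" and t
  proof -
    have "P y t - P z t = integral {t0..clamp t} (\<lambda>q. W y q - W z q)"
      unfolding P_def using that clamp[of t]
      by (subst Henstock_Kurzweil_Integration.integral_diff)
        (auto intro!: integrable_continuous_real cont_W)
    moreover have "norm (integral {t0..clamp t} (\<lambda>q. W y q - W z q))
        \<le> L * dist y z * d * (clamp t - t0)"
      by (intro integral_bound continuous_intros cont_W that)
        (use W_lip[OF that] clamp[of t] in auto)
    moreover have "L * dist y z * d * (clamp t - t0) \<le> L * dist y z * d * d"
      using clamp[of t] contr d by (intro mult_left_mono) auto
    ultimately show ?thesis
      by (simp add: dist_real_def power2_eq_square mult_ac)
  qed
  have "\<exists>!y\<in>S. \<Phi> y = y"
  proof (rule Banach_fix)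
    show "complete S" unfolding S_def by (simp add: complete_eq_closed)
    show "S \<noteq> {}" using r by (auto simp: S_def)
    show "0 \<le> L * d\<^sup>2" "L * d\<^sup>2 < 1" using contr by auto
    show "\<Phi> ` S \<subseteq> S"
      using P_bound \<Phi> by (auto simp: S_def const_bcontfun.rep_eq intro!: dist_bound)
    show "dist (\<Phi> y) (\<Phi> z) \<le> L * d\<^sup>2 * dist y z" if "y \<in> S" "z \<in> S" for y z
      using that P_lip \<Phi> by (intro dist_bound) auto
  qed
  then obtain y where y: "y \<in> S" "\<Phi> y = y" by blast
  have fixed: "y t = P y t" for t
    using \<Phi>[OF y(1)] y(2) by simp
  have nhd: "at t within {t0..} = at t within {t0..t0 + d}" if "t \<in> {t0..<t0 + d}" for t
    by (rule at_within_nhd[of _ "{..<t0 + d}"]) (use that in auto)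
  define v where "v t = a + integral {t0..t} (W y)" for t
  have v: "v t = y t" if "t \<in> {t0..t0 + d}" for t
  proof -
    have "clamp t = t" using that by (simp add: clamp_def)
    then show ?thesis by (simp add: fixed[of t] v_def P_def)
  qed
  show thesis
  proof
    show "v t0 = a" by (simp add: v_def)
    show "W y t0 = b" by (simp add: W_def)
    fix t assume t: "t \<in> {t0..<t0 + d}"
    show "(v has_real_derivative W y t) (at t within {t0..})"
      unfolding v_def nhd[OF t]
      by (rule derivative_eq_intros integral_has_real_derivative[OF cont_W] y | use d t in simp)+
    show "(W y has_real_derivative f t (v t)) (at t within {t0..})"
      using deriv_W[OF y(1), of t] t v[of t] by (simp add: nhd[OF t])
  qed
qed

text \<open>
  One-sided derivatives suffice: each branch is only tested on its own side of \<open>c\<close>, and at \<open>c\<close>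
  itself the two one-sided derivatives agree.
\<close>

lemma DERIV_glue:
  fixes f g :: "real \<Rightarrow> real"
  assumes f: "t \<le> c \<Longrightarrow> (f has_real_derivative f' t) (at t within {..c})"
    and g: "c \<le> t \<Longrightarrow> (g has_real_derivative g' t) (at t within {c..})"
    and "f c = g c" "f' c = g' c"
  shows "((\<lambda>x. if x \<le> c then f x else g x) has_real_derivative (if t \<le> c then f' t else g' t)) (at t)"
proof -
  have un: "{..c} \<union> {c..} = (UNIV :: real set)" by auto
  have "((\<lambda>x. if x \<in> {..c} then f x else g x) has_vector_derivative
      (if t \<in> {..c} then f' t else g' t)) (at t within UNIV)"
    using assms
    by (intro has_vector_derivative_If_within_closures[where T = "{c..}"])
      (auto simp: un Un_absorb1 Un_absorb2 insert_absorb has_real_derivative_iff_has_vector_derivative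
         dest!: antisym)
  then show ?thesis
    by (simp add: has_real_derivative_iff_has_vector_derivative)
qed

section \<open>Continuation\<close>

text \<open>
  The existence time depends on bounds for the data, not on the data themselves. This uniformity
  is what lets a solution be carried past the end of its interval.
\<close>

lemma cubic_ivp_uniform_step:
  fixes A B X :: real
  assumes "0 \<le> A" "0 \<le> B" "0 \<le> X"
  obtains d where "0 < d"
    and "\<And>t0 a b. t0 \<in> {0..X} \<Longrightarrow> \<bar>a\<bar> \<le> A \<Longrightarrow> \<bar>b\<bar> \<le> B \<Longrightarrow>
      \<exists>v v'. v t0 = a \<and> v' t0 = b \<and>
        (\<forall>t\<in>{t0..<t0 + d}. (v has_real_derivative v' t) (at t within {t0..}) \<and>
           (v' has_real_derivative 2 * v t ^ 3 - t * v t) (at t within {t0..}))"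
proof -
  \<comment> \<open>With a tube of radius 1 and \<open>d \<le> 1\<close>, solutions satisfy \<open>\<bar>y\<bar> \<le> R\<close> and \<open>t \<le> X + 1\<close>; \<open>C\<close> and \<open>L\<close> are the
    resulting bound and Lipschitz constant of the right-hand side.\<close>
  define R where "R = A + 1"
  define C where "C = 2 * R ^ 3 + (X + 1) * R"
  define L where "L = 6 * R\<^sup>2 + (X + 1)"
  define d where "d = 1 / (1 + B + C + L)"
  have R0: "0 \<le> R" using assms by (simp add: R_def)
  have C0: "0 \<le> C" and L0: "0 \<le> L" using R0 assms by (simp_all add: C_def L_def)
  have d0: "0 < d" and d1: "d \<le> 1"
    using C0 L0 assms by (simp_all add: d_def)
  have d2: "d\<^sup>2 \<le> d"
    using d0 d1 by (simp add: power2_eq_square mult_left_le)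
  have "(1 + B + C + L) * d = 1"
    using C0 L0 assms by (simp add: d_def)
  then have dsum: "d + B * d + C * d + L * d = 1"
    by (simp add: distrib_right)
  show thesis
  proof (rule that[OF d0])
    fix t0 a b :: real assume t0: "t0 \<in> {0..X}" and a: "\<bar>a\<bar> \<le> A" and b: "\<bar>b\<bar> \<le> B"
    have y_le: "\<bar>y\<bar> \<le> R" if "y \<in> cball a 1" for y
      using that a by (auto simp: dist_real_def R_def)
    have t_le: "0 \<le> t \<and> t \<le> X + 1" if "t \<in> {t0..t0 + d}" for t
      using that t0 d1 by auto
    show "\<exists>v v'. v t0 = a \<and> v' t0 = b \<and>
        (\<forall>t\<in>{t0..<t0 + d}. (v has_real_derivative v' t) (at t within {t0..}) \<and>
           (v' has_real_derivative 2 * v t ^ 3 - t * v t) (at t within {t0..}))"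
    proof (rule second_order_ivp_exists[of d 1 t0 a "\<lambda>t y. 2 * y ^ 3 - t * y" C L b])
      show "continuous_on ({t0..t0 + d} \<times> cball a 1) (\<lambda>(t, y). 2 * y ^ 3 - t * y)"
        unfolding case_prod_unfold by (intro continuous_intros)
    next
      fix t y assume t: "t \<in> {t0..t0 + d}" and y: "y \<in> cball a 1"
      have "\<bar>2 * y ^ 3 - t * y\<bar> \<le> 2 * \<bar>y\<bar> ^ 3 + \<bar>t\<bar> * \<bar>y\<bar>"
        using abs_triangle_ineq4[of "2 * y ^ 3" "t * y"] by (simp add: abs_mult power_abs)
      also have "\<dots> \<le> C"
        unfolding C_def using y_le[OF y] t_le[OF t] R0
        by (intro add_mono mult_mono power_mono) auto
      finally show "\<bar>2 * y ^ 3 - t * y\<bar> \<le> C" .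
    next
      fix t y z assume t: "t \<in> {t0..t0 + d}" and y: "y \<in> cball a 1" and z: "z \<in> cball a 1"
      have "(2 * y ^ 3 - t * y) - (2 * z ^ 3 - t * z)
          = (2 * (y * y + y * z + z * z) - t) * (y - z)"
        by (simp add: algebra_simps power3_eq_cube)
      then have "\<bar>(2 * y ^ 3 - t * y) - (2 * z ^ 3 - t * z)\<bar>
          = \<bar>2 * (y * y + y * z + z * z) - t\<bar> * \<bar>y - z\<bar>"
        by (simp add: abs_mult)
      also have "\<dots> \<le> L * \<bar>y - z\<bar>"
      proof (rule mult_right_mono)
        have prod_le: "\<bar>p * q\<bar> \<le> R * R" if "\<bar>p\<bar> \<le> R" "\<bar>q\<bar> \<le> R" for p q
          unfolding abs_mult by (intro mult_mono that) (use R0 in auto)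
        have "\<bar>y * y\<bar> \<le> R * R" "\<bar>y * z\<bar> \<le> R * R" "\<bar>z * z\<bar> \<le> R * R"
          using prod_le y_le[OF y] y_le[OF z] by blast+
        then show "\<bar>2 * (y * y + y * z + z * z) - t\<bar> \<le> L"
          using t_le[OF t, THEN conjunct1] t_le[OF t, THEN conjunct2]
          unfolding L_def power2_eq_square abs_le_iff distrib_left by (intro conjI) linarith+
      qed simp
      finally show "\<bar>(2 * y ^ 3 - t * y) - (2 * z ^ 3 - t * z)\<bar> \<le> L * \<bar>y - z\<bar>" .
    next
      have "\<bar>b\<bar> * d \<le> B * d" "C * d\<^sup>2 \<le> C * d"
        using b d0 d2 C0 by (auto intro: mult_right_mono mult_left_mono)
      moreover have "0 \<le> L * d" using L0 d0 by simp
      ultimately show "\<bar>b\<bar> * d + C * d\<^sup>2 \<le> 1" using dsum d0 by linarith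
    next
      have "L * d\<^sup>2 \<le> L * d" using d2 L0 by (rule mult_left_mono)
      moreover have "0 \<le> B * d" "0 \<le> C * d" using C0 d0 assms by simp_all
      ultimately show "L * d\<^sup>2 < 1" using dsum d0 by linarith
    next
      fix v v'
      assume "v t0 = a" "v' t0 = b"
        and "\<And>t. t \<in> {t0..<t0 + d} \<Longrightarrow> (v has_real_derivative v' t) (at t within {t0..})"
        and "\<And>t. t \<in> {t0..<t0 + d} \<Longrightarrow>
          (v' has_real_derivative 2 * v t ^ 3 - t * v t) (at t within {t0..})"
      then show ?thesis by (intro exI[of _ v] exI[of _ v']) blast
    qed (use d0 L0 in auto)
  qed
qed

text \<open>
  Beyond \<open>t0\<close> the original solution is discarded, even where it still exists, so the two solutions
  need not be compared on their common domain.
\<close>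

lemma ivp_solution_extend:
  assumes sol: "ivp_solution \<sigma> J s" and t0: "t0 \<in> J" "0 \<le> t0" and d: "0 < d"
    and v0: "v t0 = s t0" "v' t0 = deriv s t0"
    and v: "\<And>t. t \<in> {t0..<t0 + d} \<Longrightarrow> (v has_real_derivative v' t) (at t within {t0..})"
    and v': "\<And>t. t \<in> {t0..<t0 + d} \<Longrightarrow>
      (v' has_real_derivative 2 * v t ^ 3 - t * v t) (at t within {t0..})"
  shows "ivp_solution \<sigma> ((J \<inter> {..<t0 + d}) \<union> {0<..<t0 + d}) (\<lambda>t. if t \<le> t0 then s t else v t)"
    (is "ivp_solution \<sigma> ?K ?u")
proof -
  let ?u' = "\<lambda>t. if t \<le> t0 then deriv s t else v' t"
  have J: "open J" "is_interval J" "0 \<in> J"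
    and s: "\<And>t. t \<in> J \<Longrightarrow> (s has_real_derivative deriv s t) (at t)"
      "\<And>t. t \<in> J \<Longrightarrow> (deriv s has_real_derivative 2 * s t ^ 3 - t * s t) (at t)"
    and s0: "s 0 = 0" "deriv s 0 = \<sigma>"
    using sol by (auto simp: ivp_solution_def)
  have openK: "open ?K" using J by (intro open_Un open_Int) auto
  have in_J: "t \<in> J" if "t \<in> ?K" "t \<le> t0" for t
    using that t0 J mem_is_interval_1_I[of J 0 t0 t] by auto
  have intK: "is_interval ?K"
    unfolding is_interval_1
  proof (intro ballI allI impI)
    fix p q x assume p: "p \<in> ?K" and q: "q \<in> ?K" and x: "p \<le> x \<and> x \<le> q"
    have xd: "x < t0 + d" using q x by auto
    show "x \<in> ?K"
    proof (cases "0 < x")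
      case True then show ?thesis using xd by simp
    next
      case False
      then have "p \<in> J" using p x by auto
      then have "x \<in> J" using J False x mem_is_interval_1_I[of J p 0 x] by auto
      then show ?thesis using xd by simp
    qed
  qed
  have du: "(?u has_real_derivative ?u' t) (at t)" if "t \<in> ?K" for t
    using that s(1)[OF in_J[OF that]] v[of t] v0
    by (intro DERIV_glue) (auto intro: has_field_derivative_at_within)
  have "(?u' has_real_derivative 
      (if t \<le> t0 then 2 * s t ^ 3 - t * s t else 2 * v t ^ 3 - t * v t)) (at t)"
    if "t \<in> ?K" for t
    using that s(2)[OF in_J[OF that]] v'[of t] v0
    by (intro DERIV_glue) (auto intro: has_field_derivative_at_within)
  then have du': "(?u' has_real_derivative 2 * ?u t ^ 3 - t * ?u t) (at t)" if "t \<in> ?K" for t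
    by (rule DERIV_cong) (use that in auto)
  have deriv_u: "deriv ?u t = ?u' t" if "t \<in> ?K" for t
    using du[OF that] by (rule DERIV_imp_deriv)
  have ddu: "(deriv ?u has_real_derivative 2 * ?u t ^ 3 - t * ?u t) (at t)" if "t \<in> ?K" for t
    by (rule has_field_derivative_transform_within_open[OF du'[OF that] openK that])
      (rule deriv_u[symmetric])
  have zero: "0 \<in> ?K" using J t0 d by auto
  show ?thesis
    unfolding ivp_solution_def
    using openK intK zero du ddu deriv_u s0 t0 by auto
qed

section \<open>A priori bound\<close>

text \<open>
  The last bound is the integrated form of the Riccati inequality before it, \<open>s' / (s\<^sup>2 + \<sigma>) \<le> 1\<close>.
  Left in terms of \<open>arctan\<close>, it holds for all times; it limits \<open>s\<close> only while
  \<open>\<surd>\<sigma> t < \<pi> / 2\<close>.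
\<close>

lemma increasing_solution_bound:
  assumes sol: "ivp_solution \<sigma> J s" and \<sigma>: "0 < \<sigma>" and mono: "mono_on (J \<inter> {0..}) s"
    and t: "t \<in> J" "0 \<le> t"
  shows "0 \<le> s t" "0 \<le> deriv s t" "deriv s t \<le> (s t)\<^sup>2 + \<sigma>"
    "arctan (s t / sqrt \<sigma>) \<le> sqrt \<sigma> * t"
proof -
  have J: "open J" "is_interval J" "0 \<in> J"
    and s: "\<And>t. t \<in> J \<Longrightarrow> (s has_real_derivative deriv s t) (at t)"
      "\<And>t. t \<in> J \<Longrightarrow> (deriv s has_real_derivative 2 * s t ^ 3 - t * s t) (at t)"
    and s0: "s 0 = 0" "deriv s 0 = \<sigma>"
    using sol by (auto simp: ivp_solution_def)
  have in_J: "q \<in> J" if "0 \<le> q" "q \<le> r" "r \<in> J" for q r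
    using that J mem_is_interval_1_I[of J 0 r q] by auto
  have pos: "0 \<le> s q" if "q \<in> J" "0 \<le> q" for q
    using mono_onD[OF mono, of 0 q] that J s0 by auto
  have dpos: "0 \<le> deriv s q" if "q \<in> J" "0 \<le> q" for q
  proof (cases "q = 0")
    case True then show ?thesis using s0 \<sigma> by simp
  next
    case False
    \<comment> \<open>At \<open>q = 0\<close> monotonicity is known on one side only, hence the separate case.\<close>
    have "J \<inter> {0<..} \<subseteq> interior (J \<inter> {0..})"
      using J by (intro interior_maximal) auto
    then have "q \<in> interior (J \<inter> {0..})" using False that by auto
    then show ?thesis by (rule mono_on_imp_deriv_nonneg[OF mono s(1)[OF that(1)]])
  qed
  have dle: "deriv s q \<le> (s q)\<^sup>2 + \<sigma>" if q: "q \<in> J" "0 \<le> q" for q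
  proof -
    \<comment> \<open>The cubic term conserves this energy; the linear term can only lower it.\<close>
    have "(deriv s q)\<^sup>2 - s q ^ 4 \<le> (deriv s 0)\<^sup>2 - s 0 ^ 4"
    proof (rule DERIV_nonpos_imp_nonincreasing[OF q(2)])
      fix x assume x: "0 \<le> x" "x \<le> q"
      then have xJ: "x \<in> J" using in_J q by blast
      have "((\<lambda>x. (deriv s x)\<^sup>2 - s x ^ 4) has_real_derivative
          - (2 * x * s x * deriv s x)) (at x)"
        by (rule derivative_eq_intros s xJ refl | simp add: algebra_simps power3_eq_cube)+
      moreover have "0 \<le> 2 * x * s x * deriv s x"
        using x pos dpos xJ by simp
      ultimately show "\<exists>y. ((\<lambda>x. (deriv s x)\<^sup>2 - s x ^ 4) has_real_derivative y) (at x) \<and> y \<le> 0"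
        by (intro exI[of _ "- (2 * x * s x * deriv s x)"]) simp
    qed
    then have "(deriv s q)\<^sup>2 \<le> s q ^ 4 + \<sigma>\<^sup>2" using s0 by simp
    also have "\<dots> \<le> ((s q)\<^sup>2 + \<sigma>)\<^sup>2"
      using \<sigma> by (simp add: power2_sum flip: power_mult)
    finally show ?thesis
      by (rule power2_le_imp_le) (use \<sigma> in auto)
  qed
  show "0 \<le> s t" "0 \<le> deriv s t" "deriv s t \<le> (s t)\<^sup>2 + \<sigma>"
    using pos dpos dle t by auto
  have "arctan (s t / sqrt \<sigma>) - sqrt \<sigma> * t \<le> arctan (s 0 / sqrt \<sigma>) - sqrt \<sigma> * 0"
  proof (rule DERIV_nonpos_imp_nonincreasing[OF t(2)])
    fix x assume x: "0 \<le> x" "x \<le> t"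
    then have xJ: "x \<in> J" using in_J t by blast
    let ?D = "(deriv s x / sqrt \<sigma>) / (1 + (s x / sqrt \<sigma>)\<^sup>2) - sqrt \<sigma>"
    have "((\<lambda>x. s x / sqrt \<sigma>) has_real_derivative deriv s x / sqrt \<sigma>) (at x)"
      by (rule DERIV_cdivide[OF s(1)[OF xJ]])
    then have "((\<lambda>x. arctan (s x / sqrt \<sigma>)) has_real_derivative
        (deriv s x / sqrt \<sigma>) / (1 + (s x / sqrt \<sigma>)\<^sup>2)) (at x)"
      by (rule DERIV_chain2[OF DERIV_arctan, THEN DERIV_cong]) (simp add: field_simps)
    then have "((\<lambda>x. arctan (s x / sqrt \<sigma>) - sqrt \<sigma> * x) has_real_derivative ?D) (at x)"
      by (rule DERIV_diff) (rule DERIV_cmult_Id)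
    moreover have "?D \<le> 0"
    proof -
      have "deriv s x / sqrt \<sigma> \<le> ((s x)\<^sup>2 + \<sigma>) / sqrt \<sigma>"
        using dle[OF xJ x(1)] \<sigma> by (simp add: divide_right_mono)
      also have "\<dots> = sqrt \<sigma> * (1 + (s x / sqrt \<sigma>)\<^sup>2)"
        using \<sigma> by (simp add: field_simps power2_eq_square)
      finally have le: "deriv s x / sqrt \<sigma> \<le> sqrt \<sigma> * (1 + (s x / sqrt \<sigma>)\<^sup>2)" .
      have "0 < 1 + (s x / sqrt \<sigma>)\<^sup>2" by (simp add: add_pos_nonneg)
      from pos_divide_le_eq[OF this, THEN iffD2, OF le] show ?thesis by simp
    qed
    ultimately show "\<exists>y. ((\<lambda>x. arctan (s x / sqrt \<sigma>) - sqrt \<sigma> * x) has_real_derivative y) (at x) \<and> y \<le> 0"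
      by blast
  qed
  then show "arctan (s t / sqrt \<sigma>) \<le> sqrt \<sigma> * t" using s0 by simp
qed

section \<open>No blow-up before the critical time\<close>

theorem theorem6:
  fixes \<sigma> :: real and J :: "real set" and s :: "real \<Rightarrow> real"
  assumes "\<sigma> > 0"
    and "maximal_ivp_solution \<sigma> J s"
    and "strict_mono_on (J \<inter> {0..}) s"
  shows "\<not> (\<exists>T < pi / sqrt (4 * \<sigma>). blows_up_at J T) \<and> {0..<pi / sqrt (4 * \<sigma>)} \<subseteq> J"
proof -
  have sol: "ivp_solution \<sigma> J s"
    and maximal: "\<And>K u. ivp_solution \<sigma> K u \<Longrightarrow> K \<subseteq> J"
    using assms(2) by (auto simp: maximal_ivp_solution_def)
  have mono: "mono_on (J \<inter> {0..}) s"
    using assms(3) by (rule strict_mono_on_imp_mono_on)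
  have J: "is_interval J" "0 \<in> J"
    using sol by (auto simp: ivp_solution_def)
  have crit: "pi / sqrt (4 * \<sigma>) = (pi / 2) / sqrt \<sigma>"
    by (simp add: real_sqrt_mult)
  have sub: "{0..<pi / sqrt (4 * \<sigma>)} \<subseteq> J"
  proof (rule subsetI, rule ccontr)
    fix X assume X: "X \<in> {0..<pi / sqrt (4 * \<sigma>)}" and XJ: "X \<notin> J"
    have lt_X: "t < X" if "t \<in> J" for t
      using that XJ X J mem_is_interval_1_I[of J 0 t X] by force
    have angle: "sqrt \<sigma> * X < pi / 2" "0 \<le> sqrt \<sigma> * X"
      using X assms(1) unfolding crit by (auto simp: field_simps)
    define A where "A = sqrt \<sigma> * tan (sqrt \<sigma> * X)"
    have A0: "0 \<le> A"
      using angle assms(1) tan_gt_zero[of "sqrt \<sigma> * X"]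
      by (cases "sqrt \<sigma> * X = 0") (auto simp: A_def)
    have s_bd: "\<bar>s t\<bar> \<le> A" and s'_bd: "\<bar>deriv s t\<bar> \<le> A\<^sup>2 + \<sigma>" if t: "t \<in> J" "0 \<le> t" for t
    proof -
      note bd = increasing_solution_bound[OF sol assms(1) mono t]
      have "arctan (s t / sqrt \<sigma>) \<le> sqrt \<sigma> * X"
        using bd(4) lt_X[OF t(1)] assms(1) by (smt (verit) mult_left_mono real_sqrt_gt_zero)
      also have "\<dots> = arctan (tan (sqrt \<sigma> * X))"
        using angle by (simp add: arctan_tan)
      finally have "s t \<le> A"
        using assms(1) by (simp add: A_def pos_divide_le_eq mult.commute arctan_le_iff)
      then show "\<bar>s t\<bar> \<le> A" using bd(1) by simp
      have "(s t)\<^sup>2 \<le> A\<^sup>2" using \<open>s t \<le> A\<close> bd(1) by (intro power_mono)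
      then show "\<bar>deriv s t\<bar> \<le> A\<^sup>2 + \<sigma>" using bd(2,3) by simp
    qed
    obtain d where d: "0 < d"
      and step: "\<And>t0 a b. t0 \<in> {0..X} \<Longrightarrow> \<bar>a\<bar> \<le> A \<Longrightarrow> \<bar>b\<bar> \<le> A\<^sup>2 + \<sigma> \<Longrightarrow>
        \<exists>v v'. v t0 = a \<and> v' t0 = b \<and>
          (\<forall>t\<in>{t0..<t0 + d}. (v has_real_derivative v' t) (at t within {t0..}) \<and>
             (v' has_real_derivative 2 * v t ^ 3 - t * v t) (at t within {t0..}))"
      using cubic_ivp_uniform_step[of A "A\<^sup>2 + \<sigma>" X] A0 X assms(1)
      by (metis add_nonneg_pos atLeastLessThan_iff less_eq_real_def zero_le_power2)
    have bdd: "bdd_above J" using lt_X by (meson bdd_above.I less_imp_le)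
    have "Sup J - d < Sup J" using d by simp
    then obtain p where p: "p \<in> J" "Sup J - d < p"
      using less_cSup_iff[OF _ bdd] J by blast
    \<comment> \<open>The bounds on \<open>s\<close> and \<open>s'\<close> are only available at nonnegative times.\<close>
    define t0 where "t0 = max 0 p"
    have t0: "t0 \<in> J" "0 \<le> t0" "Sup J < t0 + d"
      using p J by (auto simp: t0_def max_def)
    have "t0 \<in> {0..X}" using t0 lt_X by force
    then obtain v v' where v: "v t0 = s t0" "v' t0 = deriv s t0"
        "\<And>t. t \<in> {t0..<t0 + d} \<Longrightarrow> (v has_real_derivative v' t) (at t within {t0..})"
        "\<And>t. t \<in> {t0..<t0 + d} \<Longrightarrow>
          (v' has_real_derivative 2 * v t ^ 3 - t * v t) (at t within {t0..})"
      using step[of t0 "s t0" "deriv s t0"] s_bd s'_bd t0 by blast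
    have "{0<..<t0 + d} \<subseteq> J"
      using maximal[OF ivp_solution_extend[OF sol t0(1,2) d v]] by blast
    moreover obtain q where q: "max (Sup J) 0 < q" "q < t0 + d"
      using t0 d dense[of "max (Sup J) 0" "t0 + d"] by auto
    ultimately have "q \<in> J" by auto
    then show False using cSup_upper[OF _ bdd, of q] q by simp
  qed
  \<comment> \<open>A blow-up time is itself excluded from \<open>J\<close>, so the inclusion already forbids an early one.\<close>
  moreover have False if "T < pi / sqrt (4 * \<sigma>)" "blows_up_at J T" for T
  proof -
    have "0 \<in> {0..<T}"
      using that(2) J unfolding blows_up_at_def by blast
    then have "T \<in> J \<inter> {0..}" using sub that(1) by auto
    then show False using that(2) unfolding blows_up_at_def by auto
  qed
  ultimately show ?thesis by blast
qed

end
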